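(* A fuzzy topological space $X$ is fuzzy weakly-compact if and only if there is no fuzzy filterbase $\Gamma$ in $X$ consisting of fuzzy weakly-closed sets such that the corresponding collection of fuzzy weakly-open sets $\{A^c\mid A\in\Gamma\}$ forms a cover of $X$, i.e. $\bigvee_{A\in\Gamma}A^c=1_X$.
   Context: Fuzzy topological spaces (FTS) are in Chang's sense: a fuzzy set in $X$ is a function $X\to[0,1]$, ordered pointwise by $\leq$, with $\vee,\wedge$ pointwise supremum and infimum and complement $A^c=1-A$; $0_X,1_X$ are the constant functions. A fuzzy topology $\tau$ on $X$ is a family of fuzzy sets containing $0_X,1_X$ and closed under finite $\wedge$ and arbitrary $\bigvee$; members of $\tau$ are fuzzy open and their complements fuzzy closed. $cl(A)$ is the infimum of all fuzzy closed sets $\geq A$ and $int(A)$ is the supremum of all fuzzy open sets $\leq A$. A fuzzy set $A$ is fuzzy semi-closed if $int(cl(A))\leq A$; a fuzzy set is fuzzy semi-open if its complement is fuzzy semi-closed. A fuzzy set $A$ is fuzzy weakly-closed if $cl(A)\leq U$ for every fuzzy semi-open set $U$ with $A\leq U$. A fuzzy set is fuzzy weakly-open if its complement is fuzzy weakly-closed. A collection $\Gamma$ of fuzzy sets in $X$ is a fuzzy filterbase if $\bigwedge_{j=1}^nA_j\neq0_X$ for every finite subcollection $\{A_1,\dots,A_n\}$ of $\Gamma$. $X$ is fuzzy weakly-compact if every family $\{G_\lambda\mid\lambda\in\Lambda\}$ of fuzzy weakly-open sets with $\bigvee_{\lambda\in\Lambda}G_\lambda=1_X$ has a finite subfamily $G_{\lambda_1},\dots,G_{\lambda_n}$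 with $\bigvee_{i=1}^nG_{\lambda_i}=1_X$. *)

theory Defs
  imports Complex_Main
begin

section \<open>The unit interval as a complete chain\<close>

typedef unit_interval = "{0..1 :: real}"
  morphisms real_of_unit unit_of_real
  by (rule exI[of _ 0]) simp

setup_lifting type_definition_unit_interval

lemma real_of_unit_bounds: "0 \<le> real_of_unit a" "real_of_unit a \<le> 1"
  using real_of_unit[of a] by auto

instantiation unit_interval :: complete_linorder
begin

lift_definition less_eq_unit_interval :: "unit_interval \<Rightarrow> unit_interval \<Rightarrow> bool" is "(\<le>)" .
lift_definition less_unit_interval :: "unit_interval \<Rightarrow> unit_interval \<Rightarrow> bool" is "(<)" .
lift_definition inf_unit_interval :: "unit_interval \<Rightarrow> unit_interval \<Rightarrow> unit_interval" is min
  by (auto simp: min_def)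
lift_definition sup_unit_interval :: "unit_interval \<Rightarrow> unit_interval \<Rightarrow> unit_interval" is max
  by (auto simp: max_def)
lift_definition bot_unit_interval :: unit_interval is 0 by simp
lift_definition top_unit_interval :: unit_interval is 1 by simp

definition Sup_unit_interval :: "unit_interval set \<Rightarrow> unit_interval"
  where "Sup S = (if S = {} then bot else unit_of_real (Sup (real_of_unit ` S)))"
definition Inf_unit_interval :: "unit_interval set \<Rightarrow> unit_interval"
  where "Inf S = (if S = {} then top else unit_of_real (Inf (real_of_unit ` S)))"

lemma bdd_real_of_unit: "bdd_above (real_of_unit ` S)" "bdd_below (real_of_unit ` S)"
  using real_of_unit_bounds by (auto intro!: bdd_aboveI[of _ 1] bdd_belowI[of _ 0])

lemma real_of_unit_Sup:
  assumes "S \<noteq> {}" shows "real_of_unit (Sup S) = Sup (real_of_unit ` S)"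
proof -
  obtain s where s: "s \<in> S" using assms by blast
  have "0 \<le> Sup (real_of_unit ` S)"
    using cSup_upper[OF imageI[OF s] bdd_real_of_unit(1)] real_of_unit_bounds(1)[of s] by linarith
  moreover have "Sup (real_of_unit ` S) \<le> 1"
    by (rule cSup_least) (use assms real_of_unit_bounds in auto)
  ultimately show ?thesis
    using assms by (simp add: Sup_unit_interval_def unit_of_real_inverse)
qed

lemma real_of_unit_Inf:
  assumes "S \<noteq> {}" shows "real_of_unit (Inf S) = Inf (real_of_unit ` S)"
proof -
  obtain s where s: "s \<in> S" using assms by blast
  have "Inf (real_of_unit ` S) \<le> 1"
    using cInf_lower[OF imageI[OF s] bdd_real_of_unit(2)] real_of_unit_bounds(2)[of s] by linarith
  moreover have "0 \<le> Inf (real_of_unit ` S)"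
    by (rule cInf_greatest) (use assms real_of_unit_bounds in auto)
  ultimately show ?thesis
    using assms by (simp add: Inf_unit_interval_def unit_of_real_inverse)
qed

instance
proof
  fix x y z :: unit_interval and A :: "unit_interval set"
  show "(x < y) = (x \<le> y \<and> \<not> y \<le> x)" by transfer auto
  show "x \<le> x" by transfer simp
  show "x \<le> y \<Longrightarrow> y \<le> z \<Longrightarrow> x \<le> z" by transfer simp
  show "x \<le> y \<Longrightarrow> y \<le> x \<Longrightarrow> x = y" by transfer simp
  show "x \<le> y \<or> y \<le> x" by transfer auto
  show "inf x y \<le> x" "inf x y \<le> y" "x \<le> sup x y" "y \<le> sup x y" by (transfer; simp)+
  show "x \<le> y \<Longrightarrow> x \<le> z \<Longrightarrow> x \<le> inf y z" by transfer simp
  show "y \<le> x \<Longrightarrow> z \<le> x \<Longrightarrow> sup y z \<le> x" by transfer simp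
  show "Sup {} = (bot :: unit_interval)" by (simp add: Sup_unit_interval_def)
  show "Inf {} = (top :: unit_interval)" by (simp add: Inf_unit_interval_def)
  show "x \<in> A \<Longrightarrow> Inf A \<le> x"
    unfolding less_eq_unit_interval.rep_eq
    by (subst real_of_unit_Inf) (auto intro: cInf_lower bdd_real_of_unit)
  show "x \<in> A \<Longrightarrow> x \<le> Sup A"
    unfolding less_eq_unit_interval.rep_eq
    by (subst real_of_unit_Sup) (auto intro: cSup_upper bdd_real_of_unit)
  show "(\<And>x. x \<in> A \<Longrightarrow> z \<le> x) \<Longrightarrow> z \<le> Inf A"
  proof (cases "A = {}")
    case True
    then show ?thesis
      by (simp add: Inf_unit_interval_def less_eq_unit_interval.rep_eq
          top_unit_interval.rep_eq real_of_unit_bounds)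
  next
    case False
    assume "\<And>x. x \<in> A \<Longrightarrow> z \<le> x"
    with False show ?thesis
      unfolding less_eq_unit_interval.rep_eq
      by (subst real_of_unit_Inf) (auto intro: cInf_greatest)
  qed
  show "(\<And>x. x \<in> A \<Longrightarrow> x \<le> z) \<Longrightarrow> Sup A \<le> z"
  proof (cases "A = {}")
    case True
    then show ?thesis
      by (simp add: Sup_unit_interval_def less_eq_unit_interval.rep_eq
          bot_unit_interval.rep_eq real_of_unit_bounds)
  next
    case False
    assume "\<And>x. x \<in> A \<Longrightarrow> x \<le> z"
    with False show ?thesis
      unfolding less_eq_unit_interval.rep_eq
      by (subst real_of_unit_Sup) (auto intro: cSup_least)
  qed
qed

end

lift_definition unit_compl :: "unit_interval \<Rightarrow> unit_interval" is "\<lambda>a. 1 - a" by simp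


section \<open>Fuzzy sets in a set X\<close>

text \<open>A map from \<open>X\<close> to \<open>[0,1]\<close> is represented by its extension by \<open>0\<close> to the whole type. On such
  functions \<open>\<le>\<close>, binary \<open>\<squnion>\<close> and \<open>\<sqinter>\<close>, arbitrary \<open>\<Squnion>\<close> and nonempty \<open>\<Sqinter>\<close> of the function lattice are the
  pointwise ones over \<open>X\<close>, and \<open>bot\<close> is the constant \<open>0\<close>. The constant \<open>1\<close> on \<open>X\<close> is
  \<open>fuzzy_one X\<close>, which differs from \<open>top\<close> unless \<open>X = UNIV\<close>.\<close>

definition fuzzy_sets :: "'a set \<Rightarrow> ('a \<Rightarrow> unit_interval) set"
  where "fuzzy_sets X = {A. \<forall>x. x \<notin> X \<longrightarrow> A x = bot}"

definition fuzzy_one :: "'a set \<Rightarrow> 'a \<Rightarrow> unit_interval"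
  where "fuzzy_one X = (\<lambda>x. if x \<in> X then top else bot)"

definition fuzzy_compl :: "'a set \<Rightarrow> ('a \<Rightarrow> unit_interval) \<Rightarrow> 'a \<Rightarrow> unit_interval"
  where "fuzzy_compl X A = (\<lambda>x. if x \<in> X then unit_compl (A x) else bot)"


section \<open>Fuzzy topological spaces in the sense of Chang\<close>

definition fuzzy_topology :: "'a set \<Rightarrow> ('a \<Rightarrow> unit_interval) set \<Rightarrow> bool"
  where "fuzzy_topology X \<tau> \<longleftrightarrow>
    \<tau> \<subseteq> fuzzy_sets X \<and> bot \<in> \<tau> \<and> fuzzy_one X \<in> \<tau> \<and>
    (\<forall>A\<in>\<tau>. \<forall>B\<in>\<tau>. inf A B \<in> \<tau>) \<and> (\<forall>F. F \<subseteq> \<tau> \<longrightarrow> Sup F \<in> \<tau>)"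

definition fuzzy_closed :: "'a set \<Rightarrow> ('a \<Rightarrow> unit_interval) set \<Rightarrow> ('a \<Rightarrow> unit_interval) \<Rightarrow> bool"
  where "fuzzy_closed X \<tau> C \<longleftrightarrow> C \<in> fuzzy_compl X ` \<tau>"

text \<open>The infimum in the closure is over a nonempty family, since \<open>fuzzy_one X\<close> is closed.\<close>

definition fuzzy_cl ::
    "'a set \<Rightarrow> ('a \<Rightarrow> unit_interval) set \<Rightarrow> ('a \<Rightarrow> unit_interval) \<Rightarrow> 'a \<Rightarrow> unit_interval"
  where "fuzzy_cl X \<tau> A = Inf {C. fuzzy_closed X \<tau> C \<and> A \<le> C}"

definition fuzzy_int ::
    "('a \<Rightarrow> unit_interval) set \<Rightarrow> ('a \<Rightarrow> unit_interval) \<Rightarrow> 'a \<Rightarrow> unit_interval"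
  where "fuzzy_int \<tau> A = Sup {U \<in> \<tau>. U \<le> A}"

definition fuzzy_semi_closed ::
    "'a set \<Rightarrow> ('a \<Rightarrow> unit_interval) set \<Rightarrow> ('a \<Rightarrow> unit_interval) \<Rightarrow> bool"
  where "fuzzy_semi_closed X \<tau> A \<longleftrightarrow>
    A \<in> fuzzy_sets X \<and> fuzzy_int \<tau> (fuzzy_cl X \<tau> A) \<le> A"

definition fuzzy_semi_open ::
    "'a set \<Rightarrow> ('a \<Rightarrow> unit_interval) set \<Rightarrow> ('a \<Rightarrow> unit_interval) \<Rightarrow> bool"
  where "fuzzy_semi_open X \<tau> A \<longleftrightarrow>
    A \<in> fuzzy_sets X \<and> fuzzy_semi_closed X \<tau> (fuzzy_compl X A)"

definition fuzzy_weakly_closed ::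
    "'a set \<Rightarrow> ('a \<Rightarrow> unit_interval) set \<Rightarrow> ('a \<Rightarrow> unit_interval) \<Rightarrow> bool"
  where "fuzzy_weakly_closed X \<tau> A \<longleftrightarrow>
    A \<in> fuzzy_sets X \<and> (\<forall>U. fuzzy_semi_open X \<tau> U \<and> A \<le> U \<longrightarrow> fuzzy_cl X \<tau> A \<le> U)"

definition fuzzy_weakly_open ::
    "'a set \<Rightarrow> ('a \<Rightarrow> unit_interval) set \<Rightarrow> ('a \<Rightarrow> unit_interval) \<Rightarrow> bool"
  where "fuzzy_weakly_open X \<tau> A \<longleftrightarrow>
    A \<in> fuzzy_sets X \<and> fuzzy_weakly_closed X \<tau> (fuzzy_compl X A)"

text \<open>Finite subcollections \<open>A\<^sub>1, \<dots>, A\<^sub>n\<close> have \<open>n \<ge> 1\<close>, both here and in the definition of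
  compactness. This only matters for empty \<open>X\<close>, where \<open>0 = 1\<close>; for nonempty \<open>X\<close> the empty
  subcollection has meet \<open>1 \<noteq> 0\<close> and join \<open>0 \<noteq> 1\<close>.\<close>

definition fuzzy_filterbase :: "'a set \<Rightarrow> ('a \<Rightarrow> unit_interval) set \<Rightarrow> bool"
  where "fuzzy_filterbase X \<Gamma> \<longleftrightarrow>
    \<Gamma> \<subseteq> fuzzy_sets X \<and> (\<forall>F. F \<subseteq> \<Gamma> \<and> finite F \<and> F \<noteq> {} \<longrightarrow> Inf F \<noteq> bot)"

definition fuzzy_weakly_compact :: "'a set \<Rightarrow> ('a \<Rightarrow> unit_interval) set \<Rightarrow> bool"
  where "fuzzy_weakly_compact X \<tau> \<longleftrightarrow>
    (\<forall>\<G>. (\<forall>G\<in>\<G>. fuzzy_weakly_open X \<tau> G) \<and> Sup \<G> = fuzzy_one X \<longrightarrow>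
      (\<exists>F. F \<subseteq> \<G> \<and> finite F \<and> F \<noteq> {} \<and> Sup F = fuzzy_one X))"

end

theory Submission
  imports Defs
begin

text \<open>Complementation is an order-reversing involution on the fuzzy sets in \<open>X\<close>.
  It exchanges weakly closed with weakly open sets and, by De Morgan
  (\<open>Sup_fuzzy_compl\<close>), infima with suprema. So a nonempty finite family has infimum
  \<open>bot\<close> exactly when its complements cover \<open>X\<close>
  (\<open>Sup_fuzzy_compl_eq_one_iff\<close>): a family of fuzzy sets fails to be a filterbase iff
  the family of complements has a finite subcover. Every weakly open cover is the family of
  complements of some weakly closed family, so a cover without finite subcover is the same thing as
  a filterbase of the forbidden kind.\<close>

lemma unit_compl_involutive [simp]: "unit_compl (unit_compl a) = a"
  by transfer simp

lemma unit_compl_le_iff: "unit_compl a \<le> unit_compl b \<longleftrightarrow> b \<le> a"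
  by transfer auto

lemma unit_compl_le_swap: "unit_compl a \<le> b \<longleftrightarrow> unit_compl b \<le> a"
  using unit_compl_le_iff[of a "unit_compl b"] by simp

lemma unit_compl_bot [simp]: "unit_compl bot = top"
  by transfer simp

text \<open>An antitone involution turns greatest lower bounds into least upper bounds; the harder
  inequality is moved across by \<open>unit_compl_le_swap\<close>.\<close>

lemma unit_compl_INF: "unit_compl (INF i\<in>I. f i) = (SUP i\<in>I. unit_compl (f i))"
proof (rule antisym)
  show "unit_compl (INF i\<in>I. f i) \<le> (SUP i\<in>I. unit_compl (f i))"
    unfolding unit_compl_le_swap[of "INF i\<in>I. f i"]
  proof (rule INF_greatest)
    fix i assume "i \<in> I"
    then have "unit_compl (f i) \<le> (SUP i\<in>I. unit_compl (f i))"
      by (rule SUP_upper)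
    then show "unit_compl (SUP i\<in>I. unit_compl (f i)) \<le> f i"
      by (simp only: unit_compl_le_swap[of "f i"])
  qed
  show "(SUP i\<in>I. unit_compl (f i)) \<le> unit_compl (INF i\<in>I. f i)"
    by (auto intro!: SUP_least INF_lower simp: unit_compl_le_iff)
qed

lemma fuzzy_compl_in_fuzzy_sets [simp]: "fuzzy_compl X A \<in> fuzzy_sets X"
  by (simp add: fuzzy_sets_def fuzzy_compl_def)

lemma fuzzy_compl_involutive [simp]:
  "A \<in> fuzzy_sets X \<Longrightarrow> fuzzy_compl X (fuzzy_compl X A) = A"
  by (auto simp: fuzzy_sets_def fuzzy_compl_def)

lemma fuzzy_compl_image_involutive:
  assumes "\<G> \<subseteq> fuzzy_sets X"
  shows "fuzzy_compl X ` fuzzy_compl X ` \<G> = \<G>"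
proof -
  have "fuzzy_compl X (fuzzy_compl X A) = A" if "A \<in> \<G>" for A
    using assms that by auto
  then show ?thesis
    by (simp add: image_image)
qed

lemma fuzzy_compl_bot: "fuzzy_compl X bot = fuzzy_one X"
  by (auto simp: fuzzy_compl_def fuzzy_one_def)

lemma fuzzy_compl_eq_one_iff:
  assumes "A \<in> fuzzy_sets X"
  shows "fuzzy_compl X A = fuzzy_one X \<longleftrightarrow> A = bot"
proof -
  have "bot \<in> fuzzy_sets X"
    by (simp add: fuzzy_sets_def)
  then show ?thesis
    using assms by (metis fuzzy_compl_bot fuzzy_compl_involutive)
qed

text \<open>A single member of \<open>F\<close> already forces the value \<open>bot\<close> off
  \<open>X\<close>. Nonemptiness matters: \<open>Inf {}\<close> is \<open>top\<close>, not
  \<open>fuzzy_one X\<close>.\<close>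

lemma Inf_in_fuzzy_sets:
  assumes "F \<subseteq> fuzzy_sets X" "F \<noteq> {}"
  shows "Inf F \<in> fuzzy_sets X"
proof -
  obtain A where "A \<in> F"
    using assms by blast
  then have "Inf F \<le> A" "A \<in> fuzzy_sets X"
    using assms by (blast intro: Inf_lower)+
  then show ?thesis
    unfolding fuzzy_sets_def le_fun_def mem_Collect_eq by (metis bot.extremum_unique)
qed

text \<open>Pointwise De Morgan on \<open>X\<close>; off \<open>X\<close> both sides are
  \<open>bot\<close>, whatever \<open>F\<close> is.\<close>

lemma Sup_fuzzy_compl: "Sup (fuzzy_compl X ` F) = fuzzy_compl X (Inf F)"
  by (auto simp: fun_eq_iff fuzzy_compl_def unit_compl_INF image_image)

text \<open>The bridge between finite subcovers and the finite meets in the definition of a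
  filterbase.\<close>

lemma Sup_fuzzy_compl_eq_one_iff:
  assumes "F \<subseteq> fuzzy_sets X" "F \<noteq> {}"
  shows "Sup (fuzzy_compl X ` F) = fuzzy_one X \<longleftrightarrow> Inf F = bot"
  by (simp add: Sup_fuzzy_compl fuzzy_compl_eq_one_iff Inf_in_fuzzy_sets assms)

lemma fuzzy_weakly_open_compl:
  "fuzzy_weakly_closed X \<tau> A \<Longrightarrow> fuzzy_weakly_open X \<tau> (fuzzy_compl X A)"
  by (simp add: fuzzy_weakly_open_def fuzzy_weakly_closed_def)

lemma fuzzy_weakly_closed_compl:
  "fuzzy_weakly_open X \<tau> G \<Longrightarrow> fuzzy_weakly_closed X \<tau> (fuzzy_compl X G)"
  by (simp add: fuzzy_weakly_open_def)

theorem theorem4p5: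
  fixes X :: "'a set" and \<tau> :: "('a \<Rightarrow> unit_interval) set"
  assumes "fuzzy_topology X \<tau>"
  shows "fuzzy_weakly_compact X \<tau> \<longleftrightarrow>
    \<not> (\<exists>\<Gamma>. fuzzy_filterbase X \<Gamma> \<and> (\<forall>A\<in>\<Gamma>. fuzzy_weakly_closed X \<tau> A) \<and>
        Sup (fuzzy_compl X ` \<Gamma>) = fuzzy_one X)"
proof
  assume compact: "fuzzy_weakly_compact X \<tau>"
  show "\<not> (\<exists>\<Gamma>. fuzzy_filterbase X \<Gamma> \<and> (\<forall>A\<in>\<Gamma>. fuzzy_weakly_closed X \<tau> A) \<and>
        Sup (fuzzy_compl X ` \<Gamma>) = fuzzy_one X)"
  proof clarify
    fix \<Gamma>
    assume fb: "fuzzy_filterbase X \<Gamma>" and wc: "\<forall>A\<in>\<Gamma>. fuzzy_weakly_closed X \<tau> A"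
      and cover: "Sup (fuzzy_compl X ` \<Gamma>) = fuzzy_one X"
    have "\<forall>G \<in> fuzzy_compl X ` \<Gamma>. fuzzy_weakly_open X \<tau> G"
      using wc by (auto intro: fuzzy_weakly_open_compl)
    with cover obtain F where F: "F \<subseteq> fuzzy_compl X ` \<Gamma>" "finite F" "F \<noteq> {}"
      and sub: "Sup F = fuzzy_one X"
      using compact[unfolded fuzzy_weakly_compact_def, rule_format,
          of "fuzzy_compl X ` \<Gamma>"] by metis
    \<comment> \<open>Choosing one preimage for each member of the finite subcover keeps the
      subfamily of \<open>\<Gamma>\<close> finite.\<close>
    obtain H where H: "H \<subseteq> \<Gamma>" "finite H" "F = fuzzy_compl X ` H"
      using finite_subset_image F by meson
    have "H \<subseteq> fuzzy_sets X" "H \<noteq> {}"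
      using fb H F unfolding fuzzy_filterbase_def by blast+
    with sub H have "Inf H = bot"
      by (simp add: Sup_fuzzy_compl_eq_one_iff)
    with fb H \<open>H \<noteq> {}\<close> show False
      unfolding fuzzy_filterbase_def by blast
  qed
next
  assume no_fb: "\<not> (\<exists>\<Gamma>. fuzzy_filterbase X \<Gamma> \<and> (\<forall>A\<in>\<Gamma>. fuzzy_weakly_closed X \<tau> A) \<and>
        Sup (fuzzy_compl X ` \<Gamma>) = fuzzy_one X)"
  show "fuzzy_weakly_compact X \<tau>"
    unfolding fuzzy_weakly_compact_def
  proof (intro allI impI, elim conjE)
    fix \<G>
    assume wo: "\<forall>G\<in>\<G>. fuzzy_weakly_open X \<tau> G" and cover: "Sup \<G> = fuzzy_one X"
    have fs: "\<G> \<subseteq> fuzzy_sets X"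
      using wo by (auto simp: fuzzy_weakly_open_def)
    \<comment> \<open>The complements of the cover are the candidate for \<open>\<Gamma>\<close>;
      since complementing twice gives back \<open>\<G>\<close>, only the filterbase property can
      fail.\<close>
    have "\<forall>A \<in> fuzzy_compl X ` \<G>. fuzzy_weakly_closed X \<tau> A"
      using wo by (auto intro: fuzzy_weakly_closed_compl)
    moreover have "Sup (fuzzy_compl X ` fuzzy_compl X ` \<G>) = fuzzy_one X"
      using cover fuzzy_compl_image_involutive[OF fs] by simp
    ultimately have "\<not> fuzzy_filterbase X (fuzzy_compl X ` \<G>)"
      using no_fb by blast
    moreover have "fuzzy_compl X ` \<G> \<subseteq> fuzzy_sets X"
      by auto
    ultimately obtain H where H: "H \<subseteq> fuzzy_compl X ` \<G>" "finite H" "H \<noteq> {}" "Inf H = bot"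
      unfolding fuzzy_filterbase_def by blast
    \<comment> \<open>The complements of the members of \<open>H\<close>, a finite subfamily with
      zero meet, form the required subcover.\<close>
    have "Sup (fuzzy_compl X ` H) = fuzzy_one X"
      using H \<open>fuzzy_compl X ` \<G> \<subseteq> fuzzy_sets X\<close> Sup_fuzzy_compl_eq_one_iff[of H X] by auto
    moreover have "fuzzy_compl X ` H \<subseteq> \<G>"
      using image_mono[OF H(1)] fuzzy_compl_image_involutive[OF fs] by metis
    ultimately show "\<exists>F. F \<subseteq> \<G> \<and> finite F \<and> F \<noteq> {} \<and> Sup F = fuzzy_one X"
      using H by (intro exI[of _ "fuzzy_compl X ` H"]) auto
  qed
qed

end
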